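(* Let $S \colon |S| \to \mathsf{2}$ be a schema, i.e. a functor from a small category $|S|$ to the interval category $\mathsf{2} = \{0 \to 1\}$ such that the fiber $S_1 := S^{-1}(1)$ is a discrete category; let $\mathsf{C} := S_0 := S^{-1}(0)$, and let $K \colon S_1 \to \mathbf{Set}$ be a functor (a typing map). Then there exists a functor $D \colon \mathsf{C} \to \mathbf{Set}$ such that the category $\mathbf{Acset}_K^S$ of $K$-typed acsets on $S$ is isomorphic to the slice category $\mathbf{Set}^{\mathsf{C}}/D$.
   Context: For a functor $S \colon |S| \to \mathsf{2}$, where $\mathsf{2} = \{0 \to 1\}$ is the category with two objects and one non-identity morphism $0 \to 1$, the fiber $S_i = S^{-1}(i)$ is the subcategory of $|S|$ of objects sent to $i$ and morphisms sent to $\mathrm{id}_i$. An acset on a schema $S$ with typing map $K \colon S_1 \to \mathbf{Set}$ is a functor $G \colon |S| \to \mathbf{Set}$ whose restriction to $S_1$ equals $K$. A morphism of acsets $G_1 \to G_2$ (with the same typing map $K$) is a natural transformation $\alpha \colon G_1 \Rightarrow G_2$ such that $\alpha|_{S_1}$ is the identity transformation on $K$. These objects and morphisms form the category $\mathbf{Acset}_K^S$. A $\mathsf{C}$-set is a functor $\mathsf{C} \to \mathbf{Set}$, and $\mathbf{Set}^{\mathsf{C}}$ is the category of $\mathsf{C}$-sets and natural transformations. *)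

theory Defs
  imports Main "HOL-Library.FuncSet" "HOL-Library.Equipollence"
begin

section \<open>Categories, functors and natural transformations\<close>

text \<open>\<open>Comp C g f\<close> is the composite \<open>g \<circ> f\<close>. The values of the operations
  outside \<open>Obj\<close> and \<open>Arr\<close> are irrelevant.\<close>

record ('o, 'm) cat =
  Obj :: "'o set"
  Arr :: "'m set"
  Dom :: "'m \<Rightarrow> 'o"
  Cod :: "'m \<Rightarrow> 'o"
  Ident :: "'o \<Rightarrow> 'm"
  Comp :: "'m \<Rightarrow> 'm \<Rightarrow> 'm"

locale category =
  fixes C :: "('o, 'm) cat"
  assumes Dom_in: "f \<in> Arr C \<Longrightarrow> Dom C f \<in> Obj C"
    and Cod_in: "f \<in> Arr C \<Longrightarrow> Cod C f \<in> Obj C"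
    and Ident_in: "x \<in> Obj C \<Longrightarrow> Ident C x \<in> Arr C"
    and Dom_Ident: "x \<in> Obj C \<Longrightarrow> Dom C (Ident C x) = x"
    and Cod_Ident: "x \<in> Obj C \<Longrightarrow> Cod C (Ident C x) = x"
    and Comp_in: "f \<in> Arr C \<Longrightarrow> g \<in> Arr C \<Longrightarrow> Cod C f = Dom C g \<Longrightarrow> Comp C g f \<in> Arr C"
    and Dom_Comp: "f \<in> Arr C \<Longrightarrow> g \<in> Arr C \<Longrightarrow> Cod C f = Dom C g \<Longrightarrow>
      Dom C (Comp C g f) = Dom C f"
    and Cod_Comp: "f \<in> Arr C \<Longrightarrow> g \<in> Arr C \<Longrightarrow> Cod C f = Dom C g \<Longrightarrow>
      Cod C (Comp C g f) = Cod C g"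
    and Comp_Ident_right: "f \<in> Arr C \<Longrightarrow> Comp C f (Ident C (Dom C f)) = f"
    and Comp_Ident_left: "f \<in> Arr C \<Longrightarrow> Comp C (Ident C (Cod C f)) f = f"
    and Comp_assoc: "f \<in> Arr C \<Longrightarrow> g \<in> Arr C \<Longrightarrow> h \<in> Arr C \<Longrightarrow>
      Cod C f = Dom C g \<Longrightarrow> Cod C g = Dom C h \<Longrightarrow>
      Comp C h (Comp C g f) = Comp C (Comp C h g) f"

definition discrete_cat :: "('o, 'm) cat \<Rightarrow> bool" where
  "discrete_cat C \<longleftrightarrow> (\<forall>f \<in> Arr C. f = Ident C (Dom C f))"

record ('o, 'm, 'p, 'n) fctr =
  obmap :: "'o \<Rightarrow> 'p"
  armap :: "'m \<Rightarrow> 'n"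

text \<open>The two maps of a functor are required to be extensional (undefined outside the
  source category), so that equality of functors is equality in HOL.\<close>

locale is_functor = C: category C + D: category D
  for C :: "('o, 'm) cat" and D :: "('p, 'n) cat" +
  fixes F :: "('o, 'm, 'p, 'n) fctr"
  assumes obmap_in: "obmap F \<in> Obj C \<rightarrow>\<^sub>E Obj D"
    and armap_in: "armap F \<in> Arr C \<rightarrow>\<^sub>E Arr D"
    and Dom_armap: "f \<in> Arr C \<Longrightarrow> Dom D (armap F f) = obmap F (Dom C f)"
    and Cod_armap: "f \<in> Arr C \<Longrightarrow> Cod D (armap F f) = obmap F (Cod C f)"
    and armap_Ident: "x \<in> Obj C \<Longrightarrow> armap F (Ident C x) = Ident D (obmap F x)"
    and armap_Comp: "f \<in> Arr C \<Longrightarrow> g \<in> Arr C \<Longrightarrow> Cod C f = Dom C g \<Longrightarrow>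
      armap F (Comp C g f) = Comp D (armap F g) (armap F f)"

definition id_fctr :: "('o, 'm) cat \<Rightarrow> ('o, 'm, 'o, 'm) fctr" where
  "id_fctr C = \<lparr>obmap = (\<lambda>x\<in>Obj C. x), armap = (\<lambda>f\<in>Arr C. f)\<rparr>"

definition comp_fctr ::
    "('o, 'm) cat \<Rightarrow> ('p, 'n, 'q, 'l) fctr \<Rightarrow> ('o, 'm, 'p, 'n) fctr \<Rightarrow> ('o, 'm, 'q, 'l) fctr" where
  "comp_fctr C G F =
    \<lparr>obmap = compose (Obj C) (obmap G) (obmap F), armap = compose (Arr C) (armap G) (armap F)\<rparr>"

definition isomorphic_cat :: "('o, 'm) cat \<Rightarrow> ('p, 'n) cat \<Rightarrow> bool" where
  "isomorphic_cat C D \<longleftrightarrow> (\<exists>F G. is_functor C D F \<and> is_functor D C G \<and>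
     comp_fctr C G F = id_fctr C \<and> comp_fctr D F G = id_fctr D)"

definition restrict_fctr :: "('o, 'm, 'p, 'n) fctr \<Rightarrow> ('o, 'm) cat \<Rightarrow> ('o, 'm, 'p, 'n) fctr" where
  "restrict_fctr F B = \<lparr>obmap = restrict (obmap F) (Obj B), armap = restrict (armap F) (Arr B)\<rparr>"

definition natural_transformation ::
    "('o, 'm) cat \<Rightarrow> ('p, 'n) cat \<Rightarrow> ('o, 'm, 'p, 'n) fctr \<Rightarrow> ('o, 'm, 'p, 'n) fctr \<Rightarrow>
     ('o \<Rightarrow> 'n) \<Rightarrow> bool" where
  "natural_transformation C D F G \<alpha> \<longleftrightarrow>
     is_functor C D F \<and> is_functor C D G \<and>
     \<alpha> \<in> Obj C \<rightarrow>\<^sub>E Arr D \<and>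
     (\<forall>x \<in> Obj C. Dom D (\<alpha> x) = obmap F x \<and> Cod D (\<alpha> x) = obmap G x) \<and>
     (\<forall>f \<in> Arr C. Comp D (\<alpha> (Cod C f)) (armap F f) = Comp D (armap G f) (\<alpha> (Dom C f)))"

definition id_nat :: "('o, 'm) cat \<Rightarrow> ('p, 'n) cat \<Rightarrow> ('o, 'm, 'p, 'n) fctr \<Rightarrow> 'o \<Rightarrow> 'n" where
  "id_nat C D F = (\<lambda>x\<in>Obj C. Ident D (obmap F x))"

text \<open>In the categories below, arrows are triples that carry their domain and codomain.\<close>

definition functor_cat :: "('o, 'm) cat \<Rightarrow> ('p, 'n) cat \<Rightarrow>
    (('o, 'm, 'p, 'n) fctr,
     ('o, 'm, 'p, 'n) fctr \<times> ('o \<Rightarrow> 'n) \<times> ('o, 'm, 'p, 'n) fctr) cat" where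
  "functor_cat C D =
    \<lparr>Obj = {F. is_functor C D F},
     Arr = {(F, \<alpha>, G). natural_transformation C D F G \<alpha>},
     Dom = (\<lambda>(F, \<alpha>, G). F),
     Cod = (\<lambda>(F, \<alpha>, G). G),
     Ident = (\<lambda>F. (F, id_nat C D F, F)),
     Comp = (\<lambda>(G, \<beta>, H) (F, \<alpha>, G'). (F, \<lambda>x\<in>Obj C. Comp D (\<beta> x) (\<alpha> x), H))\<rparr>"

text \<open>The slice of \<open>E\<close> over the object \<open>d\<close>: objects are the arrows into \<open>d\<close>.\<close>

definition slice_cat :: "('o, 'm) cat \<Rightarrow> 'o \<Rightarrow> ('m, 'm \<times> 'm \<times> 'm) cat" where
  "slice_cat E d =
    \<lparr>Obj = {p \<in> Arr E. Cod E p = d},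
     Arr = {(p, h, q). p \<in> Arr E \<and> Cod E p = d \<and> q \<in> Arr E \<and> Cod E q = d \<and>
              h \<in> Arr E \<and> Dom E h = Dom E p \<and> Cod E h = Dom E q \<and> Comp E q h = p},
     Dom = (\<lambda>(p, h, q). p),
     Cod = (\<lambda>(p, h, q). q),
     Ident = (\<lambda>p. (p, Ident E (Dom E p), p)),
     Comp = (\<lambda>(q, k, r) (p, h, q'). (p, Comp E k h, r))\<rparr>"


section \<open>The category of sets\<close>

text \<open>HOL has no type of all sets, so the category of sets is formed relative to a universe
  \<open>U\<close>, a collection of subsets of a type: its objects are the members of \<open>U\<close> and its arrows
  are all functions between them.\<close>

definition set_cat :: "'u set set \<Rightarrow> ('u set, 'u set \<times> ('u \<Rightarrow> 'u) \<times> 'u set) cat" where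
  "set_cat U =
    \<lparr>Obj = U,
     Arr = {(A, f, B). A \<in> U \<and> B \<in> U \<and> f \<in> A \<rightarrow>\<^sub>E B},
     Dom = (\<lambda>(A, f, B). A),
     Cod = (\<lambda>(A, f, B). B),
     Ident = (\<lambda>A. (A, \<lambda>x\<in>A. x, A)),
     Comp = (\<lambda>(B, g, C) (A, f, B'). (A, compose A g f, C))\<rparr>"

text \<open>An index set \<open>I\<close> is small relative to \<open>U\<close> if the product of every family of members of
  \<open>U\<close> indexed by a subset of \<open>I\<close> is again a member of \<open>U\<close>, up to bijection. This is all that
  is asked of \<open>U\<close>. It holds in particular if \<open>U\<close> consists of the elements of a Grothendieck
  universe (or of the small sets of a model of ZFC) and \<open>I\<close> is a small set there.\<close>

definition small_wrt :: "'u set set \<Rightarrow> 'i set \<Rightarrow> bool" where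
  "small_wrt U I \<longleftrightarrow>
     (\<forall>J A. J \<subseteq> I \<and> (\<forall>j\<in>J. A j \<in> U) \<longrightarrow> (\<exists>P\<in>U. Pi\<^sub>E J A \<approx> P))"

text \<open>A category is small if its set of arrows is; its set of objects embeds into the latter
  by taking identities.\<close>

definition small_cat :: "'u set set \<Rightarrow> ('o, 'm) cat \<Rightarrow> bool" where
  "small_cat U C \<longleftrightarrow> category C \<and> small_wrt U (Arr C)"

text \<open>Finite sets are small relative to the finite sets, and every set whatsoever is small
  relative to all subsets of a sufficiently large type.\<close>

lemma small_wrt_finite:
  assumes "finite I"
  shows "small_wrt {A :: nat set. finite A} I"
  unfolding small_wrt_def
proof (intro allI impI, elim conjE)
  fix J and A :: "'a \<Rightarrow> nat set"
  assume "J \<subseteq> I" "\<forall>j\<in>J. A j \<in> {A. finite A}"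
  then have fin: "finite (Pi\<^sub>E J A)"
    using assms by (auto intro: finite_PiE finite_subset)
  then have "Pi\<^sub>E J A \<approx> {..<card (Pi\<^sub>E J A)}"
    by (simp add: eqpoll_iff_card)
  then show "\<exists>P\<in>{A :: nat set. finite A}. Pi\<^sub>E J A \<approx> P"
    by blast
qed

lemma small_wrt_UNIV:
  fixes I :: "'i set"
  shows "small_wrt (UNIV :: ('i list \<Rightarrow> 'k) set set) I"
  unfolding small_wrt_def
proof (intro allI impI)
  fix J :: "'i set" and A :: "'i \<Rightarrow> ('i list \<Rightarrow> 'k) set"
  define e :: "('i \<Rightarrow> 'i list \<Rightarrow> 'k) \<Rightarrow> 'i list \<Rightarrow> 'k"
    where "e = (\<lambda>\<phi> xs. \<phi> (hd xs) (tl xs))"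
  have "inj e"
  proof (rule injI, intro ext)
    fix \<phi> \<psi> j ys
    assume "e \<phi> = e \<psi>"
    then have "e \<phi> (j # ys) = e \<psi> (j # ys)"
      by simp
    then show "\<phi> j ys = \<psi> j ys"
      by (simp add: e_def)
  qed
  then have "Pi\<^sub>E J A \<approx> e ` Pi\<^sub>E J A"
    by (metis eqpoll_sym inj_on_image_eqpoll_self inj_on_subset subset_UNIV)
  then show "\<exists>P\<in>(UNIV :: ('i list \<Rightarrow> 'k) set set). Pi\<^sub>E J A \<approx> P"
    by blast
qed


section \<open>Schemas and acsets\<close>

definition interval_cat :: "(nat, nat \<times> nat) cat" where
  "interval_cat =
    \<lparr>Obj = {0, 1},
     Arr = {(0, 0), (0, 1), (1, 1)},
     Dom = fst,
     Cod = snd,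
     Ident = (\<lambda>i. (i, i)),
     Comp = (\<lambda>g f. (fst f, snd g))\<rparr>"

definition fiber ::
    "('o, 'm) cat \<Rightarrow> ('o, 'm, nat, nat \<times> nat) fctr \<Rightarrow> nat \<Rightarrow> ('o, 'm) cat" where
  "fiber B S i = B\<lparr>Obj := {x \<in> Obj B. obmap S x = i},
                   Arr := {f \<in> Arr B. armap S f = Ident interval_cat i}\<rparr>"

text \<open>\<open>B\<close> is the total category \<open>|S|\<close>.\<close>

definition schema ::
    "'u set set \<Rightarrow> ('o, 'm) cat \<Rightarrow> ('o, 'm, nat, nat \<times> nat) fctr \<Rightarrow> bool" where
  "schema U B S \<longleftrightarrow>
     small_cat U B \<and> is_functor B interval_cat S \<and> discrete_cat (fiber B S 1)"

definition is_acset ::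
    "'u set set \<Rightarrow> ('o, 'm) cat \<Rightarrow> ('o, 'm, nat, nat \<times> nat) fctr \<Rightarrow>
     ('o, 'm, 'u set, 'u set \<times> ('u \<Rightarrow> 'u) \<times> 'u set) fctr \<Rightarrow>
     ('o, 'm, 'u set, 'u set \<times> ('u \<Rightarrow> 'u) \<times> 'u set) fctr \<Rightarrow> bool" where
  "is_acset U B S K G \<longleftrightarrow>
     is_functor B (set_cat U) G \<and> restrict_fctr G (fiber B S 1) = K"

text \<open>The subcategory of \<open>Set\<^bsup>B\<^esup>\<close> of \<open>K\<close>-typed acsets; identities and composition are those
  of the functor category.\<close>

definition acset_cat ::
    "'u set set \<Rightarrow> ('o, 'm) cat \<Rightarrow> ('o, 'm, nat, nat \<times> nat) fctr \<Rightarrow>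
     ('o, 'm, 'u set, 'u set \<times> ('u \<Rightarrow> 'u) \<times> 'u set) fctr \<Rightarrow>
     (('o, 'm, 'u set, 'u set \<times> ('u \<Rightarrow> 'u) \<times> 'u set) fctr,
      ('o, 'm, 'u set, 'u set \<times> ('u \<Rightarrow> 'u) \<times> 'u set) fctr \<times>
      ('o \<Rightarrow> 'u set \<times> ('u \<Rightarrow> 'u) \<times> 'u set) \<times>
      ('o, 'm, 'u set, 'u set \<times> ('u \<Rightarrow> 'u) \<times> 'u set) fctr) cat" where
  "acset_cat U B S K = (functor_cat B (set_cat U))
    \<lparr>Obj := {G. is_acset U B S K G},
     Arr := {(G, \<alpha>, H). is_acset U B S K G \<and> is_acset U B S K H \<and>
               natural_transformation B (set_cat U) G H \<alpha> \<and>
               restrict \<alpha> (Obj (fiber B S 1)) = id_nat (fiber B S 1) (set_cat U) K}\<rparr>"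

end

theory Submission
  imports Defs
begin

text \<open>Write \<open>J c\<close> for the arrows \<open>s\<close> of \<open>B\<close> from an object \<open>c\<close> of the fiber over \<open>0\<close> to the fiber
  over \<open>1\<close>, and let \<open>D c\<close> be the product of the sets \<open>K (Cod s)\<close> over all \<open>s \<in> J c\<close>, with
  \<open>D f\<close> acting by precomposition of the index with \<open>f\<close>. An acset \<open>G\<close> is determined by its
  restriction to the fiber over \<open>0\<close> and by the maps \<open>G s\<close>, because the fiber over \<open>1\<close> has only
  identity arrows. For fixed \<open>c\<close> the maps \<open>G s\<close> form a single map \<open>G c \<rightarrow> D c\<close>; functoriality of \<open>G\<close>
  on composites \<open>s \<circ> f\<close> is naturality of this map in \<open>c\<close>. A morphism of acsets is likewise its
  restriction to the fiber over \<open>0\<close>, and naturality at \<open>s\<close> says that it commutes with the maps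
  to \<open>D\<close>. Hence the passage to the slice is bijective on objects and on arrows.\<close>

section \<open>General category theory\<close>

text \<open>The equations are inherited, so only closure of the two subsets has to be checked. The
  fibers of a schema and the category of acsets both arise in this way.\<close>

lemma (in category) category_subcategory:
  assumes "O' \<subseteq> Obj C" and "A' \<subseteq> Arr C"
    and "\<And>f. f \<in> A' \<Longrightarrow> Dom C f \<in> O'" and "\<And>f. f \<in> A' \<Longrightarrow> Cod C f \<in> O'"
    and "\<And>x. x \<in> O' \<Longrightarrow> Ident C x \<in> A'"
    and "\<And>f g. f \<in> A' \<Longrightarrow> g \<in> A' \<Longrightarrow> Cod C f = Dom C g \<Longrightarrow> Comp C g f \<in> A'"
  shows "category (C\<lparr>Obj := O', Arr := A'\<rparr>)"
proof -
  have O: "x \<in> O' \<Longrightarrow> x \<in> Obj C" and A: "f \<in> A' \<Longrightarrow> f \<in> Arr C" for x f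
    using assms by auto
  show ?thesis
    by unfold_locales
      (simp_all add: assms O A Dom_Ident Cod_Ident Dom_Comp Cod_Comp
        Comp_Ident_right Comp_Ident_left Comp_assoc)
qed

text \<open>The inverse maps satisfy the functor laws because every object and arrow of
  \<open>D\<close> is an image under \<open>F\<close> and \<open>F\<close> is injective on both.
  Restricting \<open>inv_into\<close> makes them extensional, as functors are required to
  be.\<close>

lemma isomorphic_catI:
  assumes F: "is_functor C D F"
    and bij_Obj: "bij_betw (obmap F) (Obj C) (Obj D)"
    and bij_Arr: "bij_betw (armap F) (Arr C) (Arr D)"
  shows "isomorphic_cat C D"
proof -
  interpret is_functor C D F by fact
  define G where "G = \<lparr>obmap = (\<lambda>y\<in>Obj D. inv_into (Obj C) (obmap F) y),
    armap = (\<lambda>g\<in>Arr D. inv_into (Arr C) (armap F) g)\<rparr>"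
  have GF_ob: "obmap G (obmap F x) = x" and F_ob: "obmap F x \<in> Obj D" if "x \<in> Obj C" for x
    using that bij_Obj bij_betwE[OF bij_Obj] by (auto simp: G_def bij_betw_inv_into_left)
  have GF_ar: "armap G (armap F f) = f" and F_ar: "armap F f \<in> Arr D" if "f \<in> Arr C" for f
    using that bij_Arr bij_betwE[OF bij_Arr] by (auto simp: G_def bij_betw_inv_into_left)
  have lift_ob: "\<exists>x\<in>Obj C. y = obmap F x" if "y \<in> Obj D" for y
    using that bij_Obj unfolding bij_betw_def by blast
  have lift_ar: "\<exists>f\<in>Arr C. g = armap F f" if "g \<in> Arr D" for g
    using that bij_Arr unfolding bij_betw_def by blast
  have "is_functor D C G"
  proof unfold_locales
    show "obmap G \<in> Obj D \<rightarrow>\<^sub>E Obj C"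
      by (rule PiE_I) (use lift_ob GF_ob in \<open>force, simp add: G_def\<close>)
    show "armap G \<in> Arr D \<rightarrow>\<^sub>E Arr C"
      by (rule PiE_I) (use lift_ar GF_ar in \<open>force, simp add: G_def\<close>)
  next
    fix y assume "y \<in> Obj D"
    then show "armap G (Ident D y) = Ident C (obmap G y)"
      using lift_ob GF_ob GF_ar armap_Ident C.Ident_in by metis
  next
    fix g assume "g \<in> Arr D"
    then obtain f where "f \<in> Arr C" "g = armap F f" using lift_ar by blast
    then show "Dom C (armap G g) = obmap G (Dom D g)" "Cod C (armap G g) = obmap G (Cod D g)"
      by (simp_all add: GF_ob GF_ar Dom_armap Cod_armap C.Dom_in C.Cod_in)
  next
    fix g g' assume "g \<in> Arr D" "g' \<in> Arr D" and comp: "Cod D g = Dom D g'"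
    then obtain f f' where f: "f \<in> Arr C" "g = armap F f" "f' \<in> Arr C" "g' = armap F f'"
      using lift_ar by blast
    with comp have "Cod C f = Dom C f'"
      by (metis Cod_armap Dom_armap C.Cod_in C.Dom_in GF_ob)
    then show "armap G (Comp D g' g) = Comp C (armap G g') (armap G g)"
      using f by (metis armap_Comp C.Comp_in GF_ar)
  qed
  moreover have "comp_fctr C G F = id_fctr C"
    by (auto simp: comp_fctr_def id_fctr_def compose_def GF_ob GF_ar intro!: restrict_ext)
  moreover have "comp_fctr D F G = id_fctr D"
    using lift_ob lift_ar
    by (auto simp: comp_fctr_def id_fctr_def compose_def intro!: restrict_ext)
      (metis GF_ob, metis GF_ar)
  ultimately show ?thesis
    using F unfolding isomorphic_cat_def by blast
qed

lemma fctr_eqI: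
  assumes "is_functor C D F" "is_functor C D G"
    and "\<And>x. x \<in> Obj C \<Longrightarrow> obmap F x = obmap G x"
    and "\<And>f. f \<in> Arr C \<Longrightarrow> armap F f = armap G f"
  shows "F = (G :: ('o, 'm, 'p, 'n) fctr)"
proof -
  interpret F: is_functor C D F by fact
  interpret G: is_functor C D G by fact
  have "obmap F = obmap G" "armap F = armap G"
    using assms(3,4) F.obmap_in F.armap_in G.obmap_in G.armap_in by (auto intro: PiE_ext)
  then show ?thesis by simp
qed

text \<open>The naturality square of the composite is the pasting of the two given squares, with
  associativity in \<open>D\<close> moving the brackets.\<close>

lemma natural_transformation_Comp:
  assumes "natural_transformation C D F G \<alpha>" and "natural_transformation C D G H \<beta>"
  shows "natural_transformation C D F H (\<lambda>x\<in>Obj C. Comp D (\<beta> x) (\<alpha> x))"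
proof -
  interpret F: is_functor C D F using assms by (simp add: natural_transformation_def)
  interpret G: is_functor C D G using assms by (simp add: natural_transformation_def)
  interpret H: is_functor C D H using assms by (simp add: natural_transformation_def)
  have \<alpha>: "\<alpha> x \<in> Arr D" "Dom D (\<alpha> x) = obmap F x" "Cod D (\<alpha> x) = obmap G x"
    and \<beta>: "\<beta> x \<in> Arr D" "Dom D (\<beta> x) = obmap G x" "Cod D (\<beta> x) = obmap H x"
    if "x \<in> Obj C" for x
    using assms that by (auto simp: natural_transformation_def)
  have ar: "armap F f \<in> Arr D" "armap G f \<in> Arr D" "armap H f \<in> Arr D" if "f \<in> Arr C" for f
    using that F.armap_in G.armap_in H.armap_in by auto
  note simps = \<alpha> \<beta> ar F.C.Dom_in F.C.Cod_in F.Dom_armap F.Cod_armap G.Dom_armap G.Cod_armap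
    H.Dom_armap H.Cod_armap
  have "Comp D (Comp D (\<beta> (Cod C f)) (\<alpha> (Cod C f))) (armap F f) =
      Comp D (armap H f) (Comp D (\<beta> (Dom C f)) (\<alpha> (Dom C f)))" if f: "f \<in> Arr C" for f
  proof -
    have "Comp D (Comp D (\<beta> (Cod C f)) (\<alpha> (Cod C f))) (armap F f) =
        Comp D (\<beta> (Cod C f)) (Comp D (\<alpha> (Cod C f)) (armap F f))"
      using f by (simp add: simps F.D.Comp_assoc)
    also have "\<dots> = Comp D (\<beta> (Cod C f)) (Comp D (armap G f) (\<alpha> (Dom C f)))"
      using f assms(1) by (simp add: natural_transformation_def)
    also have "\<dots> = Comp D (Comp D (\<beta> (Cod C f)) (armap G f)) (\<alpha> (Dom C f))"
      using f by (simp add: simps F.D.Comp_assoc)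
    also have "\<dots> = Comp D (Comp D (armap H f) (\<beta> (Dom C f))) (\<alpha> (Dom C f))"
      using f assms(2) by (simp add: natural_transformation_def)
    also have "\<dots> = Comp D (armap H f) (Comp D (\<beta> (Dom C f)) (\<alpha> (Dom C f)))"
      using f by (simp add: simps F.D.Comp_assoc)
    finally show ?thesis .
  qed
  then show ?thesis
    unfolding natural_transformation_def
    using F.is_functor_axioms H.is_functor_axioms
    by (simp add: simps F.D.Comp_in F.D.Dom_Comp F.D.Cod_Comp)
qed

lemma (in is_functor) natural_transformation_id: "natural_transformation C D F F (id_nat C D F)"
proof -
  have "obmap F x \<in> Obj D" if "x \<in> Obj C" for x
    using that obmap_in by auto
  moreover have "armap F f \<in> Arr D" if "f \<in> Arr C" for f
    using that armap_in by auto
  ultimately show ?thesis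
    unfolding natural_transformation_def id_nat_def using is_functor_axioms
    by (simp add: D.Ident_in D.Dom_Ident D.Cod_Ident C.Dom_in C.Cod_in)
      (metis Dom_armap Cod_armap D.Comp_Ident_left D.Comp_Ident_right)
qed

section \<open>Functor categories\<close>

lemma functor_cat_simps [simp]:
  "Obj (functor_cat C D) = {F. is_functor C D F}"
  "Arr (functor_cat C D) = {(F, \<alpha>, G). natural_transformation C D F G \<alpha>}"
  "Dom (functor_cat C D) t = fst t"
  "Cod (functor_cat C D) t = snd (snd t)"
  "Ident (functor_cat C D) F = (F, id_nat C D F, F)"
  "Comp (functor_cat C D) s t =
    (fst t, \<lambda>x\<in>Obj C. Comp D (fst (snd s) x) (fst (snd t) x), snd (snd s))"
  by (auto simp: functor_cat_def split: prod.splits)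

lemma natural_transformationD:
  assumes "natural_transformation C D F G \<alpha>"
  shows "is_functor C D F" "is_functor C D G" "\<alpha> \<in> extensional (Obj C)"
    "x \<in> Obj C \<Longrightarrow> \<alpha> x \<in> Arr D" "x \<in> Obj C \<Longrightarrow> Dom D (\<alpha> x) = obmap F x"
    "x \<in> Obj C \<Longrightarrow> Cod D (\<alpha> x) = obmap G x"
  using assms by (auto simp: natural_transformation_def PiE_def)

lemma category_functor_cat:
  assumes "category C" and "category D"
  shows "category (functor_cat C D)"
proof -
  interpret C: category C by fact
  interpret D: category D by fact
  note nat = natural_transformationD
  show ?thesis
  proof unfold_locales
    fix t assume "t \<in> Arr (functor_cat C D)"
    then obtain F \<alpha> G where t: "t = (F, \<alpha>, G)" and \<alpha>: "natural_transformation C D F G \<alpha>"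
      by auto
    show "Dom (functor_cat C D) t \<in> Obj (functor_cat C D)"
      and "Cod (functor_cat C D) t \<in> Obj (functor_cat C D)"
      using nat(1,2)[OF \<alpha>] by (simp_all add: t)
    \<comment> \<open>The unit laws of \<open>D\<close> mention \<open>Dom D (\<alpha> x)\<close>
      and \<open>Cod D (\<alpha> x)\<close>; the flipped rules bring \<open>obmap F x\<close> and
      \<open>obmap G x\<close> into that form.\<close>
    show "Comp (functor_cat C D) t (Ident (functor_cat C D) (Dom (functor_cat C D) t)) = t"
      and "Comp (functor_cat C D) (Ident (functor_cat C D) (Cod (functor_cat C D) t)) t = t"
      using nat[OF \<alpha>]
      by (auto simp: t id_nat_def restrict_def extensional_def fun_eq_iff D.Comp_Ident_left
          D.Comp_Ident_right simp flip: nat(5,6)[OF \<alpha>])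
  next
    fix s t assume "t \<in> Arr (functor_cat C D)" "s \<in> Arr (functor_cat C D)"
      "Cod (functor_cat C D) t = Dom (functor_cat C D) s"
    then show "Comp (functor_cat C D) s t \<in> Arr (functor_cat C D)"
      by (auto intro: natural_transformation_Comp)
  next
    fix r s t assume "r \<in> Arr (functor_cat C D)" "s \<in> Arr (functor_cat C D)"
      "t \<in> Arr (functor_cat C D)" "Cod (functor_cat C D) r = Dom (functor_cat C D) s"
      "Cod (functor_cat C D) s = Dom (functor_cat C D) t"
    then show "Comp (functor_cat C D) t (Comp (functor_cat C D) s r) =
      Comp (functor_cat C D) (Comp (functor_cat C D) t s) r"
      by (auto simp: nat fun_eq_iff restrict_def intro!: D.Comp_assoc)
  qed (auto simp: is_functor.natural_transformation_id)
qed

section \<open>Slice categories\<close>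

lemma slice_cat_simps [simp]:
  "Obj (slice_cat E d) = {p \<in> Arr E. Cod E p = d}"
  "Dom (slice_cat E d) t = fst t"
  "Cod (slice_cat E d) t = snd (snd t)"
  "Ident (slice_cat E d) p = (p, Ident E (Dom E p), p)"
  "Comp (slice_cat E d) s t = (fst t, Comp E (fst (snd s)) (fst (snd t)), snd (snd s))"
  by (auto simp: slice_cat_def split: prod.splits)

lemma slice_cat_Arr:
  "(p, h, q) \<in> Arr (slice_cat E d) \<longleftrightarrow> p \<in> Arr E \<and> Cod E p = d \<and> q \<in> Arr E \<and> Cod E q = d \<and>
    h \<in> Arr E \<and> Dom E h = Dom E p \<and> Cod E h = Dom E q \<and> Comp E q h = p"
  by (simp add: slice_cat_def)

lemma (in category) category_slice_cat: "category (slice_cat C d)"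
proof unfold_locales
  fix s t assume "t \<in> Arr (slice_cat C d)" "s \<in> Arr (slice_cat C d)"
    "Cod (slice_cat C d) t = Dom (slice_cat C d) s"
  then show "Comp (slice_cat C d) s t \<in> Arr (slice_cat C d)"
    by (cases s, cases t) (simp add: slice_cat_Arr Comp_in Dom_Comp Cod_Comp Comp_assoc)
next
  fix t assume "t \<in> Arr (slice_cat C d)"
  then show "Comp (slice_cat C d) t (Ident (slice_cat C d) (Dom (slice_cat C d) t)) = t"
      "Comp (slice_cat C d) (Ident (slice_cat C d) (Cod (slice_cat C d) t)) t = t"
    using Comp_Ident_right[of "fst (snd t)"] Comp_Ident_left[of "fst (snd t)"]
    by (cases t; simp add: slice_cat_Arr)+
qed (auto simp: slice_cat_Arr Dom_in Cod_in Ident_in Dom_Ident Cod_Ident Comp_Ident_right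
    Comp_assoc)

section \<open>Functors to the category of sets\<close>

lemma set_cat_simps [simp]:
  "Obj (set_cat U) = U"
  "Dom (set_cat U) f = fst f"
  "Cod (set_cat U) f = snd (snd f)"
  "Ident (set_cat U) A = (A, \<lambda>x\<in>A. x, A)"
  "Comp (set_cat U) g f = (fst f, compose (fst f) (fst (snd g)) (fst (snd f)), snd (snd g))"
  by (auto simp: set_cat_def split: prod.splits)

lemma set_cat_Arr:
  "f \<in> Arr (set_cat U) \<longleftrightarrow>
    fst f \<in> U \<and> snd (snd f) \<in> U \<and> fst (snd f) \<in> fst f \<rightarrow>\<^sub>E snd (snd f)"
  by (cases f) (simp add: set_cat_def)

lemma set_cat_Arr_app:
  "f \<in> Arr (set_cat U) \<Longrightarrow> x \<in> fst f \<Longrightarrow> fst (snd f) x \<in> snd (snd f)"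
  by (auto simp: set_cat_Arr)

text \<open>The underlying functions are extensional on the domain, so agreement on its elements
  suffices once the outer components of the triples coincide.\<close>

lemma set_cat_Arr_eqI:
  assumes "f \<in> Arr (set_cat U)" "g \<in> Arr (set_cat U)" "fst f = fst g" "snd (snd f) = snd (snd g)"
    and "\<And>x. x \<in> fst f \<Longrightarrow> fst (snd f) x = fst (snd g) x"
  shows "f = g"
proof -
  have "fst (snd f) = fst (snd g)"
    using assms by (intro PiE_ext[of _ "fst f" "\<lambda>_. snd (snd f)"]) (simp_all add: set_cat_Arr)
  then show ?thesis using assms(3,4) by (simp add: prod_eq_iff)
qed

lemma category_set_cat: "category (set_cat U)"
  by unfold_locales
    (auto simp: set_cat_Arr compose_def prod_eq_iff fun_eq_iff PiE_def extensional_def Pi_iff)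

text \<open>With matching domains and codomains, the identity and composition laws can be tested on
  elements. This is the form in which \<open>D\<close> and \<open>glue\<close> are verified to be
  functors.\<close>

lemma set_functorI:
  assumes "category C"
    and "\<And>x. x \<in> Obj C \<Longrightarrow> obmap F x \<in> U" and "obmap F \<in> extensional (Obj C)"
    and "\<And>f. f \<in> Arr C \<Longrightarrow> armap F f \<in> Arr (set_cat U)" and "armap F \<in> extensional (Arr C)"
    and "\<And>f. f \<in> Arr C \<Longrightarrow> fst (armap F f) = obmap F (Dom C f)"
    and "\<And>f. f \<in> Arr C \<Longrightarrow> snd (snd (armap F f)) = obmap F (Cod C f)"
    and "\<And>x y. x \<in> Obj C \<Longrightarrow> y \<in> obmap F x \<Longrightarrow> fst (snd (armap F (Ident C x))) y = y"
    and "\<And>f g y. f \<in> Arr C \<Longrightarrow> g \<in> Arr C \<Longrightarrow> Cod C f = Dom C g \<Longrightarrow> y \<in> obmap F (Dom C f) \<Longrightarrow>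
      fst (snd (armap F (Comp C g f))) y = fst (snd (armap F g)) (fst (snd (armap F f)) y)"
  shows "is_functor C (set_cat U) F"
proof -
  interpret C: category C by fact
  interpret Set: category "set_cat U" by (rule category_set_cat)
  show ?thesis
  proof unfold_locales
    fix x assume "x \<in> Obj C"
    then show "armap F (Ident C x) = Ident (set_cat U) (obmap F x)"
      using Set.Ident_in[of "obmap F x"] assms
      by (intro set_cat_Arr_eqI[of _ U]) (simp_all add: C.Ident_in C.Dom_Ident C.Cod_Ident)
  next
    fix f g assume "f \<in> Arr C" "g \<in> Arr C" "Cod C f = Dom C g"
    then show "armap F (Comp C g f) = Comp (set_cat U) (armap F g) (armap F f)"
      using Set.Comp_in[of "armap F f" "armap F g"] assms
      by (intro set_cat_Arr_eqI[of _ U])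
        (simp_all add: C.Comp_in C.Dom_Comp C.Cod_Comp compose_def)
  qed (use assms in \<open>auto simp: extensional_def PiE_def\<close>)
qed

locale set_functor = is_functor C "set_cat U" F
  for C :: "('o, 'm) cat" and U :: "'u set set"
    and F :: "('o, 'm, 'u set, 'u set \<times> ('u \<Rightarrow> 'u) \<times> 'u set) fctr"
begin

lemma obmap_U: "x \<in> Obj C \<Longrightarrow> obmap F x \<in> U"
  using obmap_in by auto

lemma armap_Arr: "f \<in> Arr C \<Longrightarrow> armap F f \<in> Arr (set_cat U)"
  using armap_in by auto

lemma fst_armap: "f \<in> Arr C \<Longrightarrow> fst (armap F f) = obmap F (Dom C f)"
  and snd_armap: "f \<in> Arr C \<Longrightarrow> snd (snd (armap F f)) = obmap F (Cod C f)"
  using Dom_armap Cod_armap by auto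

lemma armap_app: "f \<in> Arr C \<Longrightarrow> y \<in> obmap F (Dom C f) \<Longrightarrow>
    fst (snd (armap F f)) y \<in> obmap F (Cod C f)"
  using set_cat_Arr_app[OF armap_Arr] by (simp add: fst_armap snd_armap)

lemma armap_Ident_app: "x \<in> Obj C \<Longrightarrow> y \<in> obmap F x \<Longrightarrow> fst (snd (armap F (Ident C x))) y = y"
  by (simp add: armap_Ident)

lemma armap_Comp_app: "f \<in> Arr C \<Longrightarrow> g \<in> Arr C \<Longrightarrow> Cod C f = Dom C g \<Longrightarrow>
    y \<in> obmap F (Dom C f) \<Longrightarrow>
    fst (snd (armap F (Comp C g f))) y = fst (snd (armap F g)) (fst (snd (armap F f)) y)"
  by (simp add: armap_Comp fst_armap compose_def)

end

text \<open>Both sides of a naturality square have the same domain and codomain, so the square can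
  be chased on elements. If \<open>F\<close> or \<open>G\<close> is not a functor, both sides of the
  equivalence are false.\<close>

lemma natural_transformation_set_iff:
  "natural_transformation C (set_cat U) F G \<alpha> \<longleftrightarrow>
    is_functor C (set_cat U) F \<and> is_functor C (set_cat U) G \<and> \<alpha> \<in> extensional (Obj C) \<and>
    (\<forall>x \<in> Obj C. \<alpha> x \<in> Arr (set_cat U) \<and> fst (\<alpha> x) = obmap F x \<and>
      snd (snd (\<alpha> x)) = obmap G x) \<and>
    (\<forall>f \<in> Arr C. \<forall>y \<in> obmap F (Dom C f).
      fst (snd (\<alpha> (Cod C f))) (fst (snd (armap F f)) y) =
      fst (snd (armap G f)) (fst (snd (\<alpha> (Dom C f))) y))" (is "?L \<longleftrightarrow> ?R")
proof (cases "is_functor C (set_cat U) F \<and> is_functor C (set_cat U) G")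
  case True
  then interpret F: set_functor C U F + G: set_functor C U G
    by (simp_all add: set_functor_def)
  have "Comp (set_cat U) (\<alpha> (Cod C f)) (armap F f) = Comp (set_cat U) (armap G f) (\<alpha> (Dom C f))
      \<longleftrightarrow> (\<forall>y \<in> obmap F (Dom C f).
      fst (snd (\<alpha> (Cod C f))) (fst (snd (armap F f)) y) =
      fst (snd (armap G f)) (fst (snd (\<alpha> (Dom C f))) y))"
    if "f \<in> Arr C" "\<forall>x \<in> Obj C. fst (\<alpha> x) = obmap F x \<and> snd (snd (\<alpha> x)) = obmap G x" for f
    using that
    by (auto simp: F.fst_armap G.snd_armap F.C.Dom_in F.C.Cod_in compose_def restrict_def fun_eq_iff)
  \<comment> \<open>\<open>Comp\<close> has to stay folded for the equivalence just proved to
    apply.\<close>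
  then show ?thesis
    using True by (auto simp: natural_transformation_def PiE_def Pi_iff simp del: set_cat_simps(5))
qed (auto simp: natural_transformation_def)


lemma (in is_functor) is_functor_restrict:
  assumes "category C'" and "C' = C\<lparr>Obj := O', Arr := A'\<rparr>" and "O' \<subseteq> Obj C" and "A' \<subseteq> Arr C"
  shows "is_functor C' D (restrict_fctr F C')"
proof -
  interpret C': category C' by fact
  show ?thesis
    using assms(2-) C'.Dom_in C'.Cod_in C'.Ident_in C'.Comp_in
      obmap_in armap_in Dom_armap Cod_armap armap_Ident armap_Comp
    by unfold_locales (auto simp: restrict_fctr_def subset_iff PiE_iff)
qed

section \<open>Schemas\<close>

text \<open>The pair \<open>(0, 1)\<close> is the non-identity arrow of the interval. For a schema
  these are the arrows from \<open>c\<close> that belong to neither fiber, and there are none unless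
  \<open>c\<close> lies over 0.\<close>

definition crossing :: "('o, 'm) cat \<Rightarrow> ('o, 'm, nat, nat \<times> nat) fctr \<Rightarrow> 'o \<Rightarrow> 'm set" where
  "crossing B S c = {s \<in> Arr B. Dom B s = c \<and> armap S s = (0, 1)}"

locale interval_functor = is_functor B interval_cat S
  for B :: "('o, 'm) cat" and S :: "('o, 'm, nat, nat \<times> nat) fctr"
begin

abbreviation "B0 \<equiv> fiber B S 0"
abbreviation "B1 \<equiv> fiber B S 1"
abbreviation "J \<equiv> crossing B S"

lemma fiber_simps [simp]:
  "Dom (fiber B S i) = Dom B" "Cod (fiber B S i) = Cod B"
  "Ident (fiber B S i) = Ident B" "Comp (fiber B S i) = Comp B"
  by (simp_all add: fiber_def)

lemma Obj_fiber: "x \<in> Obj (fiber B S i) \<longleftrightarrow> x \<in> Obj B \<and> obmap S x = i"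
  and Arr_fiber: "f \<in> Arr (fiber B S i) \<longleftrightarrow> f \<in> Arr B \<and> armap S f = (i, i)"
  by (simp_all add: fiber_def interval_cat_def)

lemma obmap_S: "f \<in> Arr B \<Longrightarrow> obmap S (Dom B f) = fst (armap S f)"
   "f \<in> Arr B \<Longrightarrow> obmap S (Cod B f) = snd (armap S f)"
  using Dom_armap Cod_armap by (simp_all add: interval_cat_def)

lemma armap_S_Comp: "f \<in> Arr B \<Longrightarrow> g \<in> Arr B \<Longrightarrow> Cod B f = Dom B g \<Longrightarrow>
    armap S (Comp B g f) = (fst (armap S f), snd (armap S g))"
  by (simp add: armap_Comp) (simp add: interval_cat_def)

lemma armap_S_Ident: "x \<in> Obj B \<Longrightarrow> armap S (Ident B x) = (obmap S x, obmap S x)"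
  by (simp add: armap_Ident) (simp add: interval_cat_def)

lemma category_fiber: "category (fiber B S i)"
  unfolding fiber_def
  by (rule C.category_subcategory)
    (auto simp: C.Dom_in C.Cod_in C.Ident_in C.Comp_in armap_S_Comp armap_S_Ident obmap_S
      interval_cat_def)

lemma Obj_cases:
  assumes "x \<in> Obj B" obtains "x \<in> Obj B0" "x \<notin> Obj B1" | "x \<in> Obj B1" "x \<notin> Obj B0"
  using assms obmap_in by (force simp: Obj_fiber interval_cat_def)

text \<open>The interval has no arrow from 1 to 0, which leaves the two fibers and the crossing
  arrows.\<close>

lemma Arr_cases:
  assumes "f \<in> Arr B" obtains "f \<in> Arr B0" | "f \<in> J (Dom B f)" | "f \<in> Arr B1"
  using assms armap_in by (force simp: Arr_fiber crossing_def interval_cat_def)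

lemma Arr_fiber_in:
  assumes "f \<in> Arr (fiber B S i)"
  shows "f \<in> Arr B" "Dom B f \<in> Obj (fiber B S i)" "Cod B f \<in> Obj (fiber B S i)"
  using assms by (simp_all add: Arr_fiber Obj_fiber C.Dom_in C.Cod_in obmap_S)

lemma Obj_fiber_in: "x \<in> Obj (fiber B S i) \<Longrightarrow> x \<in> Obj B"
  by (simp add: Obj_fiber)

lemma crossing_in:
  assumes "s \<in> J c"
  shows "s \<in> Arr B" "Dom B s = c" "c \<in> Obj B0" "Cod B s \<in> Obj B1" "s \<notin> Arr B0" "s \<notin> Arr B1"
  using assms by (auto simp: crossing_def Obj_fiber Arr_fiber C.Dom_in C.Cod_in obmap_S)

text \<open>Precomposition with \<open>f\<close> carries indices at \<open>Cod B f\<close> to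
  indices at \<open>Dom B f\<close>, against the direction of \<open>f\<close>. Reindexing a product
  along this map is therefore covariant in \<open>f\<close>.\<close>

lemma Comp_crossing: "f \<in> Arr B0 \<Longrightarrow> s \<in> J (Cod B f) \<Longrightarrow> Comp B s f \<in> J (Dom B f)"
  by (auto simp: crossing_def Arr_fiber C.Comp_in C.Dom_Comp armap_S_Comp)

lemma restrict_fiber:
  assumes "is_functor B D G"
  shows "is_functor (fiber B S i) D (restrict_fctr G (fiber B S i))"
  by (rule is_functor.is_functor_restrict[OF assms category_fiber fiber_def]) auto

lemma obmap_restrict_fiber:
    "x \<in> Obj (fiber B S i) \<Longrightarrow> obmap (restrict_fctr G (fiber B S i)) x = obmap G x"
  and armap_restrict_fiber:
    "f \<in> Arr (fiber B S i) \<Longrightarrow> armap (restrict_fctr G (fiber B S i)) f = armap G f"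
  by (simp_all add: restrict_fctr_def)

end

text \<open>The map \<open>d c\<close> encodes the product of the sets \<open>K (Cod s)\<close> over all \<open>s \<in> J c\<close> as the
  member \<open>P c\<close> of the universe.\<close>

locale typed_schema = interval_functor B S + K: set_functor "fiber B S 1" U K
  for U :: "'u set set" and B :: "('o, 'm) cat" and S
    and K :: "('o, 'm, 'u set, 'u set \<times> ('u \<Rightarrow> 'u) \<times> 'u set) fctr" +
  fixes P :: "'o \<Rightarrow> 'u set" and d :: "'o \<Rightarrow> 'u \<Rightarrow> 'm \<Rightarrow> 'u"
  assumes discrete: "discrete_cat (fiber B S 1)"
    and P_in: "c \<in> Obj (fiber B S 0) \<Longrightarrow> P c \<in> U"
    and bij_d: "c \<in> Obj (fiber B S 0) \<Longrightarrow>
      bij_betw (d c) (P c) (\<Pi>\<^sub>E s\<in>crossing B S c. obmap K (Cod B s))"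
begin

text \<open>The decoding \<open>d c\<close> lists the coordinates of an element of
  \<open>P c\<close>; this is its inverse. The restriction makes the family extensional, so that
  only its values on \<open>J c\<close> matter.\<close>

definition e :: "'o \<Rightarrow> ('m \<Rightarrow> 'u) \<Rightarrow> 'u" where
  "e c \<phi> = inv_into (P c) (d c) (restrict \<phi> (J c))"

lemma Arr_B1: "f \<in> Arr B1 \<Longrightarrow> f = Ident B (Dom B f)" "f \<in> Arr B1 \<Longrightarrow> Cod B f = Dom B f"
proof -
  show *: "f = Ident B (Dom B f)" if "f \<in> Arr B1" for f
    using discrete that unfolding discrete_cat_def fiber_simps by blast
  show "Cod B f = Dom B f" if "f \<in> Arr B1"
    using *[OF that] that by (metis C.Cod_Ident C.Dom_in Arr_fiber_in(1))
qed

lemma d_in: "c \<in> Obj B0 \<Longrightarrow> y \<in> P c \<Longrightarrow> s \<in> J c \<Longrightarrow> d c y s \<in> obmap K (Cod B s)"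
  using PiE_mem[OF bij_betw_apply[OF bij_d]] .

text \<open>\<open>d c\<close> is injective with extensional values, so the coordinates separate the
  elements of \<open>P c\<close>. All equations in the products are proved through this
  principle.\<close>

lemma P_eqI:
  assumes "c \<in> Obj B0" "y \<in> P c" "z \<in> P c" "\<And>s. s \<in> J c \<Longrightarrow> d c y s = d c z s"
  shows "y = z"
proof -
  have "d c y = d c z"
    using bij_betw_apply[OF bij_d] assms by (intro PiE_ext[of _ "J c" "\<lambda>s. obmap K (Cod B s)"]) auto
  then show ?thesis
    using inj_onD[OF bij_betw_imp_inj_on[OF bij_d]] assms by blast
qed

text \<open>The universal property of the product: a family of elements of the factors lies in the
  image of \<open>d c\<close>, so it has a code with these coordinates.\<close>

lemma
  assumes "c \<in> Obj B0" "\<And>s. s \<in> J c \<Longrightarrow> \<phi> s \<in> obmap K (Cod B s)"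
  shows e_in: "e c \<phi> \<in> P c" and d_e: "s \<in> J c \<Longrightarrow> d c (e c \<phi>) s = \<phi> s"
proof -
  have *: "restrict \<phi> (J c) \<in> (\<Pi>\<^sub>E s\<in>J c. obmap K (Cod B s))"
    using assms by auto
  then show "e c \<phi> \<in> P c"
    using bij_betw_apply[OF bij_betw_inv_into[OF bij_d]] assms(1) by (simp add: e_def)
  from * show "d c (e c \<phi>) s = \<phi> s" if "s \<in> J c"
    using that bij_betw_inv_into_right[OF bij_d *] assms(1) by (simp add: e_def)
qed

section \<open>The functor of products over the crossing arrows\<close>

definition D :: "('o, 'm, 'u set, 'u set \<times> ('u \<Rightarrow> 'u) \<times> 'u set) fctr" where
  "D = \<lparr>obmap = (\<lambda>c\<in>Obj B0. P c),
    armap = (\<lambda>f\<in>Arr B0. (P (Dom B f),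
      \<lambda>y\<in>P (Dom B f). e (Cod B f) (\<lambda>s. d (Dom B f) y (Comp B s f)), P (Cod B f)))\<rparr>"

lemma D_simps:
  "c \<in> Obj B0 \<Longrightarrow> obmap D c = P c"
  "f \<in> Arr B0 \<Longrightarrow> fst (armap D f) = P (Dom B f)"
  "f \<in> Arr B0 \<Longrightarrow> snd (snd (armap D f)) = P (Cod B f)"
  by (simp_all add: D_def)

text \<open>\<open>Comp B s f\<close> is an index at \<open>Dom B f\<close> with the same codomain
  as \<open>s\<close>, so the reindexed coordinates lie in the right factors and \<open>e\<close>
  can encode them.\<close>

lemma
  assumes "f \<in> Arr B0" "y \<in> P (Dom B f)"
  shows D_app_in: "fst (snd (armap D f)) y \<in> P (Cod B f)"
    and d_D: "s \<in> J (Cod B f) \<Longrightarrow> d (Cod B f) (fst (snd (armap D f)) y) s = d (Dom B f) y (Comp B s f)"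
proof -
  have *: "d (Dom B f) y (Comp B s f) \<in> obmap K (Cod B s)" if "s \<in> J (Cod B f)" for s
    using d_in[OF Arr_fiber_in(2)[OF assms(1)] assms(2) Comp_crossing[OF assms(1) that]]
      crossing_in[OF that] Arr_fiber_in(1)[OF assms(1)] by (simp add: C.Cod_Comp)
  show "fst (snd (armap D f)) y \<in> P (Cod B f)"
    using assms Arr_fiber_in[OF assms(1)] * by (simp add: D_def e_in)
  show "d (Cod B f) (fst (snd (armap D f)) y) s = d (Dom B f) y (Comp B s f)" if "s \<in> J (Cod B f)"
    using assms Arr_fiber_in[OF assms(1)] * that by (simp add: D_def d_e)
qed

text \<open>Coordinate by coordinate, the identity law reduces to the right unit law of
  \<open>B\<close>, and the composition law to associativity of \<open>B\<close> for
  \<open>f\<close>, \<open>g\<close> and a crossing arrow \<open>s\<close>.\<close>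

lemma functor_D: "is_functor B0 (set_cat U) D"
proof (rule set_functorI[OF category_fiber])
  interpret B0: category B0 by (rule category_fiber)
  show "armap D f \<in> Arr (set_cat U)" if "f \<in> Arr B0" for f
    using that D_app_in[OF that] Arr_fiber_in[OF that] P_in
    by (auto simp: set_cat_Arr D_def)
  show "fst (snd (armap D (Ident B0 c))) y = y" if "c \<in> Obj B0" "y \<in> obmap D c" for c y
  proof -
    have c: "Ident B c \<in> Arr B0" "Dom B (Ident B c) = c" "Cod B (Ident B c) = c"
      using B0.Ident_in B0.Dom_Ident B0.Cod_Ident that(1) by auto
    have y: "y \<in> P c" using that by (simp add: D_simps)
    show ?thesis
    proof (rule P_eqI[OF that(1) _ y])
      show "fst (snd (armap D (Ident B0 c))) y \<in> P c"
        using D_app_in[OF c(1)] y by (simp add: c)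
      show "d c (fst (snd (armap D (Ident B0 c))) y) s = d c y s" if s: "s \<in> J c" for s
        using d_D[OF c(1), of y s] y s crossing_in(1,2)[OF s] C.Comp_Ident_right[of s]
        by (simp add: c)
    qed
  qed
  show "fst (snd (armap D (Comp B0 g f))) y = fst (snd (armap D g)) (fst (snd (armap D f)) y)"
    if f: "f \<in> Arr B0" and g: "g \<in> Arr B0" and fg: "Cod B0 f = Dom B0 g" and "y \<in> obmap D (Dom B0 f)"
    for f g y
  proof -
    have y: "y \<in> P (Dom B f)" using that by (simp add: D_simps Arr_fiber_in)
    have gf: "Comp B g f \<in> Arr B0" "Dom B (Comp B g f) = Dom B f" "Cod B (Comp B g f) = Cod B g"
      using B0.Comp_in B0.Dom_Comp B0.Cod_Comp f g fg by auto
    have y': "fst (snd (armap D f)) y \<in> P (Dom B g)" using D_app_in[OF f y] fg by simp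
    have "d (Cod B g) (fst (snd (armap D (Comp B g f))) y) s =
        d (Cod B g) (fst (snd (armap D g)) (fst (snd (armap D f)) y)) s" if s: "s \<in> J (Cod B g)" for s
      using d_D[OF gf(1), of y s] d_D[OF g y' s] d_D[OF f y, of "Comp B s g"]
        Comp_crossing[OF g s] C.Comp_assoc[of f g s] crossing_in[OF s] f g fg y s
      by (simp add: gf Arr_fiber_in(1))
    then show ?thesis
      using P_eqI[of "Cod B g"] D_app_in[OF gf(1)] D_app_in[OF g y'] y Arr_fiber_in(3)[OF g]
      by (simp add: gf)
  qed
qed (auto simp: D_def Arr_fiber_in P_in)

section \<open>Acsets as objects of the slice\<close>

text \<open>Tupling of the maps \<open>G s\<close> over all \<open>s\<close> in \<open>J c\<close>.
  The outer restriction makes the family extensional, as the components of a natural transformation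
  must be.\<close>

definition transpose :: "('o, 'm, 'u set, 'u set \<times> ('u \<Rightarrow> 'u) \<times> 'u set) fctr \<Rightarrow>
    'o \<Rightarrow> 'u set \<times> ('u \<Rightarrow> 'u) \<times> 'u set" where
  "transpose G = (\<lambda>c\<in>Obj B0. (obmap G c,
    \<lambda>x\<in>obmap G c. e c (\<lambda>s. fst (snd (armap G s)) x), P c))"

text \<open>An object of the slice is an arrow of the functor category into \<open>D\<close>, and
  such an arrow is a triple, so the restriction of \<open>G\<close> is part of the object.\<close>

abbreviation "over G \<equiv> (restrict_fctr G B0, transpose G, D)"

lemma acset_set_functor: "is_acset U B S K G \<Longrightarrow> set_functor B U G"
  by (simp add: is_acset_def set_functor_def)

lemma acset_K:
  assumes "is_acset U B S K G" "a \<in> Obj B1" shows "obmap G a = obmap K a"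
  using assms obmap_restrict_fiber[OF assms(2), of G] by (simp add: is_acset_def)

text \<open>\<open>Cod B s\<close> lies over 1, where \<open>G\<close> agrees with \<open>K\<close>.
  The values of the maps \<open>G s\<close> at \<open>x\<close> therefore form an element of the
  product.\<close>

lemma
  assumes G: "is_acset U B S K G" and c: "c \<in> Obj B0" and x: "x \<in> obmap G c"
  shows transpose_in: "fst (snd (transpose G c)) x \<in> P c"
    and d_transpose: "s \<in> J c \<Longrightarrow> d c (fst (snd (transpose G c)) x) s = fst (snd (armap G s)) x"
proof -
  interpret G: set_functor B U G using G by (rule acset_set_functor)
  have *: "fst (snd (armap G s)) x \<in> obmap K (Cod B s)" if "s \<in> J c" for s
    using G.armap_app[of s x] x crossing_in[OF that] acset_K[OF G] by auto
  show "fst (snd (transpose G c)) x \<in> P c"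
    using c x * by (simp add: transpose_def e_in)
  show "d c (fst (snd (transpose G c)) x) s = fst (snd (armap G s)) x" if "s \<in> J c"
    using c x * that by (simp add: transpose_def d_e)
qed

text \<open>In coordinate \<open>s\<close> both paths around the square give the value of
  \<open>G\<close> at the composite \<open>Comp B s f\<close>: one by functoriality of
  \<open>G\<close>, the other by the action of \<open>D\<close> on coordinates.\<close>

lemma natural_transpose:
  assumes G: "is_acset U B S K G"
  shows "natural_transformation B0 (set_cat U) (restrict_fctr G B0) D (transpose G)"
proof -
  interpret G: set_functor B U G using G by (rule acset_set_functor)
  have fn: "is_functor B (set_cat U) G" using G by (simp add: is_acset_def)
  have Arr: "transpose G c \<in> Arr (set_cat U)" if "c \<in> Obj B0" for c
    using transpose_in[OF G that] that P_in[OF that] G.obmap_U[of c]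
    by (auto simp: set_cat_Arr transpose_def Obj_fiber)
  have "fst (snd (transpose G (Cod B f))) (fst (snd (armap G f)) y) =
      fst (snd (armap D f)) (fst (snd (transpose G (Dom B f))) y)"
    if f: "f \<in> Arr B0" and y: "y \<in> obmap G (Dom B f)" for f y
  proof (rule P_eqI)
    note f' = Arr_fiber_in[OF f]
    have fy: "fst (snd (armap G f)) y \<in> obmap G (Cod B f)"
      using G.armap_app f' y by auto
    show "Cod B f \<in> Obj B0" using f' by simp
    show "fst (snd (transpose G (Cod B f))) (fst (snd (armap G f)) y) \<in> P (Cod B f)"
      using f' fy by (simp add: transpose_in[OF G])
    have ty: "fst (snd (transpose G (Dom B f))) y \<in> P (Dom B f)"
      using f' y by (simp add: transpose_in[OF G])
    then show "fst (snd (armap D f)) (fst (snd (transpose G (Dom B f))) y) \<in> P (Cod B f)"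
      using D_app_in[OF f] by simp
    fix s assume s: "s \<in> J (Cod B f)"
    show "d (Cod B f) (fst (snd (transpose G (Cod B f))) (fst (snd (armap G f)) y)) s =
      d (Cod B f) (fst (snd (armap D f)) (fst (snd (transpose G (Dom B f))) y)) s"
      using crossing_in[OF s] f' y fy
      by (simp add: d_D[OF f ty s] d_transpose[OF G] s Comp_crossing[OF f s] G.armap_Comp_app)
  qed
  then show ?thesis
    using Arr functor_D restrict_fiber[OF fn]
    by (auto simp: natural_transformation_set_iff obmap_restrict_fiber armap_restrict_fiber
        Arr_fiber_in D_simps) (auto simp: transpose_def)
qed

section \<open>The category of acsets\<close>

lemma acset_cat_simps [simp]:
  "Obj (acset_cat U B S K) = {G. is_acset U B S K G}"
  "Dom (acset_cat U B S K) t = fst t"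
  "Cod (acset_cat U B S K) t = snd (snd t)"
  "Ident (acset_cat U B S K) G = (G, id_nat B (set_cat U) G, G)"
  "Comp (acset_cat U B S K) t' t =
    (fst t, \<lambda>x\<in>Obj B. Comp (set_cat U) (fst (snd t') x) (fst (snd t) x), snd (snd t'))"
  by (simp_all add: acset_cat_def del: set_cat_simps)

lemma acset_cat_Arr:
  "(G, \<alpha>, H) \<in> Arr (acset_cat U B S K) \<longleftrightarrow> is_acset U B S K G \<and> is_acset U B S K H \<and>
    natural_transformation B (set_cat U) G H \<alpha> \<and>
    (\<forall>a\<in>Obj B1. \<alpha> a = Ident (set_cat U) (obmap K a))"
proof -
  have "restrict \<alpha> (Obj B1) = id_nat B1 (set_cat U) K \<longleftrightarrow>
      (\<forall>a\<in>Obj B1. \<alpha> a = Ident (set_cat U) (obmap K a))"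
    unfolding id_nat_def by (metis (mono_tags, lifting) restrict_apply' restrict_ext)
  then show ?thesis
    by (simp add: acset_cat_def del: set_cat_simps)
qed

lemma category_acset_cat: "category (acset_cat U B S K)"
proof -
  interpret BSet: category "functor_cat B (set_cat U)"
    by (rule category_functor_cat) (rule C.category_axioms category_set_cat)+
  let ?A = "acset_cat U B S K"
  have "category (functor_cat B (set_cat U) \<lparr>Obj := Obj ?A, Arr := Arr ?A\<rparr>)"
  proof (rule BSet.category_subcategory)
    fix t t' assume t: "t \<in> Arr ?A" "t' \<in> Arr ?A"
      and comp: "Cod (functor_cat B (set_cat U)) t = Dom (functor_cat B (set_cat U)) t'"
    obtain F \<alpha> G \<beta> H where tt': "t = (F, \<alpha>, G)" "t' = (G, \<beta>, H)"
      using comp by (cases t; cases t') auto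
    \<comment> \<open>Over the fiber over 1 both components are the identity of
      \<open>obmap K a\<close>; this is what keeps the additional condition on morphisms closed
      under composition.\<close>
    have "Comp (set_cat U) (\<beta> a) (\<alpha> a) = Ident (set_cat U) (obmap K a)" if "a \<in> Obj B1" for a
      using t that by (simp add: tt' acset_cat_Arr) (simp add: compose_def fun_eq_iff)
    then show "Comp (functor_cat B (set_cat U)) t' t \<in> Arr ?A"
      using t natural_transformation_Comp[of B "set_cat U" F G \<alpha> H \<beta>]
      by (simp add: tt' acset_cat_Arr Obj_fiber_in del: set_cat_simps)
  next
    fix G assume "G \<in> Obj ?A"
    then have G: "is_acset U B S K G" by simp
    then have "natural_transformation B (set_cat U) G G (id_nat B (set_cat U) G)"
      by (simp add: is_acset_def is_functor.natural_transformation_id)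
    then show "Ident (functor_cat B (set_cat U)) G \<in> Arr ?A"
      using G acset_K[OF G] by (simp add: acset_cat_Arr id_nat_def Obj_fiber_in)
  next
    show "Arr ?A \<subseteq> Arr (functor_cat B (set_cat U))"
      by (auto simp: acset_cat_Arr)
    show "Obj ?A \<subseteq> Obj (functor_cat B (set_cat U))"
      by (auto simp: is_acset_def)
    fix t assume "t \<in> Arr ?A"
    then show "Dom (functor_cat B (set_cat U)) t \<in> Obj ?A"
      and "Cod (functor_cat B (set_cat U)) t \<in> Obj ?A"
      by (cases t; simp add: acset_cat_Arr)+
  qed
  moreover have "functor_cat B (set_cat U) \<lparr>Obj := Obj ?A, Arr := Arr ?A\<rparr> = ?A"
    unfolding acset_cat_def by simp
  ultimately show ?thesis
    by simp
qed

section \<open>The comparison functor to the slice category\<close>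

abbreviation "E \<equiv> functor_cat B0 (set_cat U)"

lemma category_E: "category E"
  by (rule category_functor_cat) (rule category_fiber category_set_cat)+

lemma restrict_natural:
  assumes "natural_transformation B (set_cat U) G H \<alpha>"
  shows "natural_transformation B0 (set_cat U) (restrict_fctr G B0) (restrict_fctr H B0)
    (restrict \<alpha> (Obj B0))"
  using assms restrict_fiber[of "set_cat U" G 0] restrict_fiber[of "set_cat U" H 0]
  by (simp add: natural_transformation_set_iff obmap_restrict_fiber armap_restrict_fiber
      Arr_fiber_in Obj_fiber_in)

text \<open>Read in coordinate \<open>s\<close>, the triangle over \<open>D\<close> is the
  naturality square at \<open>s\<close> with an identity as its component over 1. One direction
  turns acset morphisms into slice arrows, the other lifts slice arrows back.\<close>

lemma transpose_comp_iff:
  assumes G: "is_acset U B S K G" and H: "is_acset U B S K H" and c: "c \<in> Obj B0"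
    and \<eta>: "\<eta> \<in> Arr (set_cat U)" "fst \<eta> = obmap G c" "snd (snd \<eta>) = obmap H c"
  shows "Comp (set_cat U) (transpose H c) \<eta> = transpose G c \<longleftrightarrow>
    (\<forall>s\<in>J c. \<forall>x\<in>obmap G c. fst (snd (armap H s)) (fst (snd \<eta>) x) = fst (snd (armap G s)) x)"
    (is "?L \<longleftrightarrow> ?R")
proof -
  have \<eta>x: "fst (snd \<eta>) x \<in> obmap H c" if "x \<in> obmap G c" for x
    using set_cat_Arr_app[OF \<eta>(1)] \<eta> that by simp
  have "?L \<longleftrightarrow> (\<forall>x\<in>obmap G c. fst (snd (transpose H c)) (fst (snd \<eta>) x) = fst (snd (transpose G c)) x)"
    using c \<eta> by (auto simp: transpose_def prod_eq_iff fun_eq_iff compose_def)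
  also have "\<dots> \<longleftrightarrow> (\<forall>x\<in>obmap G c. \<forall>s\<in>J c. d c (fst (snd (transpose H c)) (fst (snd \<eta>) x)) s =
      d c (fst (snd (transpose G c)) x) s)"
  proof (rule ball_cong[OF refl])
    fix x assume x: "x \<in> obmap G c"
    show "fst (snd (transpose H c)) (fst (snd \<eta>) x) = fst (snd (transpose G c)) x \<longleftrightarrow>
      (\<forall>s\<in>J c. d c (fst (snd (transpose H c)) (fst (snd \<eta>) x)) s = d c (fst (snd (transpose G c)) x) s)"
      using P_eqI[OF c transpose_in[OF H c \<eta>x[OF x]] transpose_in[OF G c x]] by auto
  qed
  also have "\<dots> \<longleftrightarrow> ?R"
    using d_transpose[OF G c] d_transpose[OF H c] \<eta>x by auto
  finally show ?thesis .
qed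

text \<open>A slice arrow carries its two end objects around an arrow of the functor category, which
  is itself a triple; hence the nesting.\<close>

definition to_slice where
  "to_slice = \<lparr>obmap = (\<lambda>G\<in>Obj (acset_cat U B S K). over G),
    armap = (\<lambda>t\<in>Arr (acset_cat U B S K).
      (over (fst t),
       (restrict_fctr (fst t) B0, restrict (fst (snd t)) (Obj B0), restrict_fctr (snd (snd t)) B0),
       over (snd (snd t))))\<rparr>"

text \<open>The component of \<alpha> at \<open>Cod B s\<close> is an identity, so naturality at a
  crossing arrow \<open>s\<close> reduces to the condition that characterises the triangle.\<close>

lemma transpose_acset_Arr:
  assumes "(G, \<alpha>, H) \<in> Arr (acset_cat U B S K)" and c: "c \<in> Obj B0"
  shows "Comp (set_cat U) (transpose H c) (\<alpha> c) = transpose G c"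
proof -
  have G: "is_acset U B S K G" and H: "is_acset U B S K H"
    and \<alpha>: "natural_transformation B (set_cat U) G H \<alpha>"
    and id: "\<And>a. a \<in> Obj B1 \<Longrightarrow> \<alpha> a = Ident (set_cat U) (obmap K a)"
    using assms(1) unfolding acset_cat_Arr by auto
  interpret G: set_functor B U G using G by (rule acset_set_functor)
  have "fst (snd (armap H s)) (fst (snd (\<alpha> c)) x) = fst (snd (armap G s)) x"
    if "s \<in> J c" "x \<in> obmap G c" for s x
  proof -
    note s = crossing_in[OF that(1)]
    have "fst (snd (\<alpha> (Cod B s))) (fst (snd (armap G s)) x) =
        fst (snd (armap H s)) (fst (snd (\<alpha> c)) x)"
      using \<alpha> s that(2) by (auto simp: natural_transformation_set_iff)
    then show ?thesis
      using G.armap_app[of s x] s that(2) id[of "Cod B s"] acset_K[OF G, of "Cod B s"] by simp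
  qed
  moreover have "c \<in> Obj B" using c by (simp add: Obj_fiber)
  ultimately show ?thesis
    using \<alpha> transpose_comp_iff[OF G H c, of "\<alpha> c"] by (simp add: natural_transformation_set_iff)
qed

lemma functor_to_slice: "is_functor (acset_cat U B S K) (slice_cat E D) to_slice"
proof -
  interpret A: category "acset_cat U B S K" by (rule category_acset_cat)
  interpret E: category E by (rule category_E)
  interpret L: category "slice_cat E D" by (rule E.category_slice_cat)
  \<comment> \<open>The slice condition is an equation between whole families, so the componentwise
    triangles are collected; off \<open>Obj B0\<close> both sides are
    \<open>undefined\<close>.\<close>
  have comp: "(\<lambda>x\<in>Obj B0. Comp (set_cat U) (transpose H x) (restrict \<alpha> (Obj B0) x)) = transpose G"
    if "(G, \<alpha>, H) \<in> Arr (acset_cat U B S K)" for G \<alpha> H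
    using transpose_acset_Arr[OF that]
    by (intro ext) (auto simp: transpose_def simp del: set_cat_simps)
  show ?thesis
  proof unfold_locales
    show "obmap to_slice \<in> Obj (acset_cat U B S K) \<rightarrow>\<^sub>E Obj (slice_cat E D)"
      using natural_transpose by (auto simp: to_slice_def)
    have "armap to_slice t \<in> Arr (slice_cat E D)" if "t \<in> Arr (acset_cat U B S K)" for t
    proof (cases t)
      case (fields G \<alpha> H)
      then have t: "(G, \<alpha>, H) \<in> Arr (acset_cat U B S K)" using that by simp
      then show ?thesis
        using comp[OF t] natural_transpose restrict_natural
        by (simp add: to_slice_def slice_cat_Arr fields del: set_cat_simps) (simp add: acset_cat_Arr)
    qed
    then show "armap to_slice \<in> Arr (acset_cat U B S K) \<rightarrow>\<^sub>E Arr (slice_cat E D)"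
      by (simp add: PiE_iff) (simp add: to_slice_def)
  next
    fix G assume "G \<in> Obj (acset_cat U B S K)"
    then show "armap to_slice (Ident (acset_cat U B S K) G) = Ident (slice_cat E D) (obmap to_slice G)"
      using A.Ident_in[of G]
      by (auto simp: to_slice_def id_nat_def Obj_fiber obmap_restrict_fiber fun_eq_iff restrict_def
          restrict_fctr_def)
  next
    fix t assume "t \<in> Arr (acset_cat U B S K)"
    then show "Dom (slice_cat E D) (armap to_slice t) = obmap to_slice (Dom (acset_cat U B S K) t)"
      and "Cod (slice_cat E D) (armap to_slice t) = obmap to_slice (Cod (acset_cat U B S K) t)"
      using A.Dom_in A.Cod_in by (auto simp: to_slice_def)
  next
    fix t t' assume "t \<in> Arr (acset_cat U B S K)" "t' \<in> Arr (acset_cat U B S K)"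
      "Cod (acset_cat U B S K) t = Dom (acset_cat U B S K) t'"
    then show "armap to_slice (Comp (acset_cat U B S K) t' t) =
        Comp (slice_cat E D) (armap to_slice t') (armap to_slice t)"
      using A.Comp_in[of t t']
      by (auto simp: to_slice_def Obj_fiber fun_eq_iff restrict_def)
  qed
qed

section \<open>Bijectivity on objects\<close>

text \<open>Over 0 the values are read off from the restriction, over 1 from \<open>K\<close>, and
  the map at a crossing arrow from the corresponding coordinate of the transpose.\<close>

lemma inj_over:
  assumes G: "is_acset U B S K G" and H: "is_acset U B S K H" and eq: "over G = over H"
  shows "G = H"
proof (rule fctr_eqI)
  interpret G: set_functor B U G using G by (rule acset_set_functor)
  interpret H: set_functor B U H using H by (rule acset_set_functor)
  show "is_functor B (set_cat U) G" "is_functor B (set_cat U) H"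
    using G H by (simp_all add: is_acset_def)
  have ob0: "obmap G x = obmap H x" if "x \<in> Obj B0" for x
    using eq obmap_restrict_fiber[OF that] by (metis prod.inject)
  have ar0: "armap G f = armap H f" if "f \<in> Arr B0" for f
    using eq armap_restrict_fiber[OF that] by (metis prod.inject)
  have ar1: "armap G f = armap H f" if "f \<in> Arr B1" for f
    using G H armap_restrict_fiber[OF that] by (metis is_acset_def)
  show ob: "obmap G x = obmap H x" if "x \<in> Obj B" for x
    using that by (cases rule: Obj_cases) (simp_all add: ob0 acset_K[OF G] acset_K[OF H])
  show "armap G f = armap H f" if "f \<in> Arr B" for f
    using that
  proof (cases rule: Arr_cases)
    case 2
    show ?thesis
    proof (rule set_cat_Arr_eqI[OF G.armap_Arr H.armap_Arr])
      fix x assume "x \<in> fst (armap G f)"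
      then have x: "x \<in> obmap G (Dom B f)" "x \<in> obmap H (Dom B f)"
        using that ob by (simp_all add: G.fst_armap C.Dom_in)
      have "transpose G = transpose H" using eq by simp
      then show "fst (snd (armap G f)) x = fst (snd (armap H f)) x"
        using d_transpose[OF G crossing_in(3)[OF 2] x(1) 2]
          d_transpose[OF H crossing_in(3)[OF 2] x(2) 2] by simp
    qed (use that ob in \<open>simp_all add: G.fst_armap H.fst_armap G.snd_armap H.snd_armap C.Dom_in C.Cod_in\<close>)
  qed (simp_all add: ar0 ar1)
qed

text \<open>The inverse of \<open>over\<close>. The last branch of the arrow map is reached exactly
  by the crossing arrows, where coordinate \<open>f\<close> of \<pi> supplies the function.\<close>

definition glue where
  "glue F \<pi> = \<lparr>obmap = (\<lambda>x\<in>Obj B. if x \<in> Obj B0 then obmap F x else obmap K x),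
    armap = (\<lambda>f\<in>Arr B. if f \<in> Arr B0 then armap F f else if f \<in> Arr B1 then armap K f
      else (obmap F (Dom B f), \<lambda>x\<in>obmap F (Dom B f). d (Dom B f) (fst (snd (\<pi> (Dom B f))) x) f,
        obmap K (Cod B f)))\<rparr>"

lemma glue_simps:
  "x \<in> Obj B0 \<Longrightarrow> obmap (glue F \<pi>) x = obmap F x"
  "x \<in> Obj B1 \<Longrightarrow> obmap (glue F \<pi>) x = obmap K x"
  "f \<in> Arr B0 \<Longrightarrow> armap (glue F \<pi>) f = armap F f"
  "f \<in> Arr B1 \<Longrightarrow> armap (glue F \<pi>) f = armap K f"
  "f \<in> J c \<Longrightarrow> armap (glue F \<pi>) f =
    (obmap F c, \<lambda>x\<in>obmap F c. d c (fst (snd (\<pi> c)) x) f, obmap K (Cod B f))"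
  by (auto simp: glue_def Obj_fiber Arr_fiber crossing_def)

context
  fixes F \<pi>
  assumes \<pi>: "natural_transformation B0 (set_cat U) F D \<pi>"
begin

interpretation F: set_functor B0 U F
  using \<pi> by (simp add: set_functor_def natural_transformation_def)

lemma \<pi>_app:
  assumes "c \<in> Obj B0" "x \<in> obmap F c"
  shows "fst (snd (\<pi> c)) x \<in> P c"
  using assms \<pi> set_cat_Arr_app[of "\<pi> c" U x]
  by (simp add: natural_transformation_set_iff D_simps)

text \<open>Naturality of \<pi> read in coordinate \<open>s\<close>. This is the functor law of
  \<open>glue\<close> for an arrow over 0 followed by a crossing arrow.\<close>

lemma \<pi>_natural:
  assumes f: "f \<in> Arr B0" and "s \<in> J (Cod B f)" "x \<in> obmap F (Dom B f)"
  shows "d (Cod B f) (fst (snd (\<pi> (Cod B f))) (fst (snd (armap F f)) x)) s =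
    d (Dom B f) (fst (snd (\<pi> (Dom B f))) x) (Comp B s f)"
  using assms \<pi> d_D[OF f \<pi>_app[OF Arr_fiber_in(2)[OF f] assms(3)] assms(2)]
  by (simp add: natural_transformation_set_iff)

text \<open>The composition law splits by the position of \<open>f\<close> and \<open>g\<close>.
  Inside a fiber it is that of \<open>F\<close> or \<open>K\<close>, before a crossing arrow it is
  naturality of \<pi>, and after a crossing arrow only an identity can follow.\<close>

lemma functor_glue: "is_functor B (set_cat U) (glue F \<pi>)"
proof (rule set_functorI[OF C.category_axioms])
  fix f assume f: "f \<in> Arr B"
  from f show "armap (glue F \<pi>) f \<in> Arr (set_cat U)"
  proof (cases rule: Arr_cases)
    case 2
    then show ?thesis
      using crossing_in[OF 2] d_in[OF _ \<pi>_app] F.obmap_U K.obmap_U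
      by (auto simp: set_cat_Arr glue_simps)
  qed (simp_all add: glue_simps F.armap_Arr K.armap_Arr)
  have "fst (armap (glue F \<pi>) f) = obmap (glue F \<pi>) (Dom B f) \<and>
    snd (snd (armap (glue F \<pi>) f)) = obmap (glue F \<pi>) (Cod B f)"
    using f
  proof (cases rule: Arr_cases)
    case 2
    then show ?thesis
      using crossing_in(3,4)[OF 2] by (simp add: glue_simps)
  qed (simp_all add: glue_simps F.fst_armap F.snd_armap K.fst_armap K.snd_armap Arr_fiber_in)
  then show "fst (armap (glue F \<pi>) f) = obmap (glue F \<pi>) (Dom B f)"
    and "snd (snd (armap (glue F \<pi>) f)) = obmap (glue F \<pi>) (Cod B f)"
    by simp_all
next
  fix x y assume "x \<in> Obj B" "y \<in> obmap (glue F \<pi>) x"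
  then show "fst (snd (armap (glue F \<pi>) (Ident B x))) y = y"
    using F.armap_Ident_app[of x y] K.armap_Ident_app[of x y] F.C.Ident_in[of x] K.C.Ident_in[of x]
    by (cases rule: Obj_cases) (simp_all add: glue_simps)
next
  fix f g y
  assume f: "f \<in> Arr B" and g: "g \<in> Arr B" and fg: "Cod B f = Dom B g"
    and y: "y \<in> obmap (glue F \<pi>) (Dom B f)"
  let ?G = "glue F \<pi>"
  from f show "fst (snd (armap ?G (Comp B g f))) y =
    fst (snd (armap ?G g)) (fst (snd (armap ?G f)) y)"
  proof (cases rule: Arr_cases)
    case f0: 1
    have y': "y \<in> obmap F (Dom B f)" using y f0 by (simp add: glue_simps Arr_fiber_in)
    from g show ?thesis
    proof (cases rule: Arr_cases)
      case 1
      then show ?thesis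
        using f0 fg y' F.C.Comp_in[of f g] F.armap_Comp_app[of f g y] by (simp add: glue_simps)
    next
      case 2
      then have gJ: "g \<in> J (Cod B f)" using fg by simp
      have "fst (snd (armap F f)) y \<in> obmap F (Cod B f)"
        using F.armap_app f0 y' by simp
      then show ?thesis
        using \<pi>_natural[OF f0 gJ y'] f0 y' Comp_crossing[OF f0 gJ] gJ by (simp add: glue_simps)
    next
      \<comment> \<open>Impossible: \<open>f\<close> ends over 0 while \<open>g\<close> starts over
        1.\<close>
      case 3
      then show ?thesis using f0 fg Arr_fiber_in(2)[OF 3] Arr_fiber_in(3)[OF f0] by (simp add: Obj_fiber)
    qed
  next
    case 2
    \<comment> \<open>\<open>f\<close> ends over 1 and no arrow leaves that fiber, so
      \<open>g\<close> lies in it and is an identity by discreteness.\<close>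
    have "g \<in> Arr B1"
      using g by (cases rule: Arr_cases) (use crossing_in(4)[OF 2] fg Arr_fiber_in(2) crossing_in(3)
        in \<open>force simp: Obj_fiber\<close>)+
    moreover have "fst (snd (armap ?G f)) y \<in> obmap K (Cod B f)"
      using y crossing_in[OF 2] d_in[OF _ \<pi>_app] 2 by (simp add: glue_simps)
    ultimately show ?thesis
      using fg Arr_B1[of g] C.Comp_Ident_left[OF f] K.armap_Ident_app[of "Cod B f"]
        crossing_in(4)[OF 2] by (simp add: glue_simps)
  next
    case 3
    have "g \<in> Arr B1"
      using g by (cases rule: Arr_cases) (use Arr_fiber_in(3)[OF 3] fg Arr_fiber_in(2) crossing_in(3)
        in \<open>force simp: Obj_fiber\<close>)+
    moreover have "y \<in> obmap K (Dom B f)" using y 3 by (simp add: glue_simps Arr_fiber_in)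
    ultimately show ?thesis
      using 3 fg K.C.Comp_in[of f g] K.armap_Comp_app[of f g y] by (simp add: glue_simps)
  qed
next
  show "obmap (glue F \<pi>) x \<in> U" if "x \<in> Obj B" for x
    using that by (cases rule: Obj_cases) (simp_all add: glue_simps F.obmap_U K.obmap_U)
qed (simp_all add: glue_def)

lemma acset_glue: "is_acset U B S K (glue F \<pi>)"
proof -
  have "restrict_fctr (glue F \<pi>) B1 = K"
    using restrict_fiber[OF functor_glue] K.is_functor_axioms
    by (rule fctr_eqI) (simp_all add: obmap_restrict_fiber armap_restrict_fiber glue_simps)
  then show ?thesis
    using functor_glue by (simp add: is_acset_def)
qed

text \<open>On the objects over 0 the transpose has the same coordinates as \<pi>, since the glued
  arrows were built from them. Elsewhere both families are \<open>undefined\<close>.\<close>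

lemma over_glue: "over (glue F \<pi>) = (F, \<pi>, D)"
proof -
  have "restrict_fctr (glue F \<pi>) B0 = F"
    using restrict_fiber[OF functor_glue] F.is_functor_axioms
    by (rule fctr_eqI) (simp_all add: obmap_restrict_fiber armap_restrict_fiber glue_simps)
  moreover have "transpose (glue F \<pi>) c = \<pi> c" for c
  proof (cases "c \<in> Obj B0")
    case c: True
    have \<pi>c: "\<pi> c \<in> Arr (set_cat U)" "fst (\<pi> c) = obmap F c" "snd (snd (\<pi> c)) = P c"
      using c \<pi> by (simp_all add: natural_transformation_set_iff D_simps)
    have "transpose (glue F \<pi>) c \<in> Arr (set_cat U)"
      using c natural_transpose[OF acset_glue] by (simp add: natural_transformation_set_iff)
    then show ?thesis
    proof (rule set_cat_Arr_eqI[OF _ \<pi>c(1)])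
      fix x assume "x \<in> fst (transpose (glue F \<pi>) c)"
      then have x: "x \<in> obmap F c" and x': "x \<in> obmap (glue F \<pi>) c"
        using c by (simp_all add: transpose_def glue_simps)
      show "fst (snd (transpose (glue F \<pi>) c)) x = fst (snd (\<pi> c)) x"
        by (rule P_eqI[OF c transpose_in[OF acset_glue c x'] \<pi>_app[OF c x]])
          (use d_transpose[OF acset_glue c x'] x in \<open>simp add: glue_simps\<close>)
    qed (use c \<pi>c in \<open>simp_all add: transpose_def glue_simps\<close>)
  next
    case False
    then show ?thesis using \<pi> by (simp add: natural_transformation_set_iff transpose_def extensional_def)
  qed
  ultimately show ?thesis by auto
qed

end

lemma bij_Obj_to_slice:
  "bij_betw (obmap to_slice) (Obj (acset_cat U B S K)) (Obj (slice_cat E D))"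
proof (rule bij_betw_imageI)
  show "inj_on (obmap to_slice) (Obj (acset_cat U B S K))"
    using inj_over by (auto simp: inj_on_def to_slice_def)
  show "obmap to_slice ` Obj (acset_cat U B S K) = Obj (slice_cat E D)"
  proof (intro equalityI subsetI)
    fix p assume "p \<in> Obj (slice_cat E D)"
    then obtain F \<pi> where "p = (F, \<pi>, D)" "natural_transformation B0 (set_cat U) F D \<pi>" by auto
    then have "p = obmap to_slice (glue F \<pi>)" "glue F \<pi> \<in> Obj (acset_cat U B S K)"
      using over_glue acset_glue by (auto simp: to_slice_def)
    then show "p \<in> obmap to_slice ` Obj (acset_cat U B S K)" by blast
  qed (use PiE_mem[OF is_functor.obmap_in[OF functor_to_slice]] in blast)
qed

section \<open>Bijectivity on arrows\<close>

text \<open>\<eta> is extended by identities over 1, where \<open>G\<close> and \<open>H\<close>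
  both agree with \<open>K\<close>. Naturality over 0 is that of \<eta>, at a crossing arrow it is
  the triangle over \<open>D\<close>, and over 1 all arrows are identities.\<close>

lemma lift_slice_Arr:
  assumes G: "is_acset U B S K G" and H: "is_acset U B S K H"
    and h: "(over G, (restrict_fctr G B0, \<eta>, restrict_fctr H B0), over H) \<in> Arr (slice_cat E D)"
  obtains \<alpha> where "(G, \<alpha>, H) \<in> Arr (acset_cat U B S K)" "restrict \<alpha> (Obj B0) = \<eta>"
proof
  interpret G: set_functor B U G using G by (rule acset_set_functor)
  interpret H: set_functor B U H using H by (rule acset_set_functor)
  have \<eta>: "natural_transformation B0 (set_cat U) (restrict_fctr G B0) (restrict_fctr H B0) \<eta>"
    and comp': "(\<lambda>c\<in>Obj B0. Comp (set_cat U) (transpose H c) (\<eta> c)) = transpose G"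
    using h by (simp_all add: slice_cat_Arr del: set_cat_simps)
  have comp: "Comp (set_cat U) (transpose H c) (\<eta> c) = transpose G c" if "c \<in> Obj B0" for c
    using that fun_cong[OF comp', of c] by (simp del: set_cat_simps)
  have \<eta>_Arr: "\<eta> c \<in> Arr (set_cat U)" "fst (\<eta> c) = obmap G c" "snd (snd (\<eta> c)) = obmap H c"
    if "c \<in> Obj B0" for c
    using that \<eta> by (simp_all add: natural_transformation_set_iff obmap_restrict_fiber)
  have \<eta>_ext: "\<eta> \<in> extensional (Obj B0)"
    using \<eta> by (simp add: natural_transformation_set_iff)
  define \<alpha> where "\<alpha> = (\<lambda>x\<in>Obj B. if x \<in> Obj B0 then \<eta> x else Ident (set_cat U) (obmap K x))"
  have \<alpha>0: "\<alpha> x = \<eta> x" if "x \<in> Obj B0" for x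
    using that by (simp add: \<alpha>_def Obj_fiber)
  have \<alpha>1: "\<alpha> x = Ident (set_cat U) (obmap K x)" if "x \<in> Obj B1" for x
    using that by (auto simp: \<alpha>_def Obj_fiber)
  show "restrict \<alpha> (Obj B0) = \<eta>"
    using \<alpha>0 \<eta>_ext by (auto simp: extensional_def fun_eq_iff)
  have "natural_transformation B (set_cat U) G H \<alpha>"
    unfolding natural_transformation_set_iff
  proof (intro conjI ballI)
    show "is_functor B (set_cat U) G" "is_functor B (set_cat U) H"
      using G H by (simp_all add: is_acset_def)
    show "\<alpha> \<in> extensional (Obj B)" by (simp add: \<alpha>_def)
  next
    fix x assume "x \<in> Obj B"
    then have "\<alpha> x \<in> Arr (set_cat U) \<and> fst (\<alpha> x) = obmap G x \<and> snd (snd (\<alpha> x)) = obmap H x"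
    proof (cases rule: Obj_cases)
      case 1
      then show ?thesis by (simp add: \<alpha>0 \<eta>_Arr)
    next
      case 2
      then show ?thesis
        by (simp add: \<alpha>1 acset_K[OF G] acset_K[OF H] set_cat_Arr K.obmap_U)
    qed
    then show "\<alpha> x \<in> Arr (set_cat U)" "fst (\<alpha> x) = obmap G x" "snd (snd (\<alpha> x)) = obmap H x"
      by simp_all
  next
    fix f y assume f: "f \<in> Arr B" and y: "y \<in> obmap G (Dom B f)"
    from f show "fst (snd (\<alpha> (Cod B f))) (fst (snd (armap G f)) y) =
      fst (snd (armap H f)) (fst (snd (\<alpha> (Dom B f))) y)"
    proof (cases rule: Arr_cases)
      case 1
      then show ?thesis
        using \<eta> y by (simp add: natural_transformation_set_iff \<alpha>0 Arr_fiber_in obmap_restrict_fiber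
            armap_restrict_fiber)
    next
      case 2
      note f' = crossing_in[OF 2]
      have "fst (snd (armap G f)) y \<in> obmap K (Cod B f)"
        using G.armap_app[OF f y] f' acset_K[OF G] by simp
      then show ?thesis
        using transpose_comp_iff[OF G H f'(3) \<eta>_Arr[OF f'(3)]] comp[OF f'(3)] 2 y f'
        by (simp add: \<alpha>0 \<alpha>1 del: set_cat_simps(5))
    next
      case 3
      note f' = Arr_B1[OF 3] Arr_fiber_in[OF 3]
      have "y \<in> obmap K (Dom B f)" "y \<in> obmap H (Dom B f)"
        using y acset_K[OF G] acset_K[OF H] f' by simp_all
      then show ?thesis
        using f' y G.armap_Ident_app[of "Dom B f" y] H.armap_Ident_app[of "Dom B f" y]
        by (simp add: \<alpha>1 C.Dom_in)
    qed
  qed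
  then show "(G, \<alpha>, H) \<in> Arr (acset_cat U B S K)"
    using G H \<alpha>1 by (simp add: acset_cat_Arr)
qed

text \<open>Injectivity holds because the components over 0 survive in the restriction, those over 1
  are prescribed identities, and outside \<open>Obj B\<close> all are \<open>undefined\<close>.
  Surjectivity is the lifting of slice arrows.\<close>

lemma bij_Arr_to_slice:
  "bij_betw (armap to_slice) (Arr (acset_cat U B S K)) (Arr (slice_cat E D))"
proof (rule bij_betw_imageI)
  show "inj_on (armap to_slice) (Arr (acset_cat U B S K))"
  proof (rule inj_onI)
    fix t t' assume t: "t \<in> Arr (acset_cat U B S K)" "t' \<in> Arr (acset_cat U B S K)"
      and eq: "armap to_slice t = armap to_slice t'"
    obtain G \<alpha> H G' \<alpha>' H' where tt': "t = (G, \<alpha>, H)" "t' = (G', \<alpha>', H')"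
      by (cases t; cases t') auto
    have "over G = over G'" "over H = over H'" "restrict \<alpha> (Obj B0) = restrict \<alpha>' (Obj B0)"
      using eq t by (simp_all add: to_slice_def tt')
    moreover from this have "\<alpha> x = \<alpha>' x" for x
    proof (cases "x \<in> Obj B")
      case True
      then show ?thesis
        by (cases rule: Obj_cases)
          (use calculation(3) t in \<open>metis restrict_apply', simp add: tt' acset_cat_Arr\<close>)
    next
      case False
      then show ?thesis
        using t by (simp add: tt' acset_cat_Arr natural_transformation_set_iff extensional_def)
    qed
    ultimately show "t = t'"
      using t inj_over by (simp add: tt' acset_cat_Arr fun_eq_iff)
  qed
  show "armap to_slice ` Arr (acset_cat U B S K) = Arr (slice_cat E D)"
  proof (intro equalityI subsetI)
    fix u assume u: "u \<in> Arr (slice_cat E D)"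
    interpret L: category "slice_cat E D"
      by (rule category.category_slice_cat[OF category_E])
    \<comment> \<open>Bijectivity on objects presents both ends of \<open>u\<close> as images of
      acsets, which brings \<open>u\<close> into the shape that can be lifted.\<close>
    have "\<exists>G. is_acset U B S K G \<and> p = over G" if "p \<in> Obj (slice_cat E D)" for p
    proof -
      have "p \<in> obmap to_slice ` Obj (acset_cat U B S K)"
        using that by (simp only: bij_betw_imp_surj_on[OF bij_Obj_to_slice])
      then obtain G where "G \<in> Obj (acset_cat U B S K)" "p = obmap to_slice G"
        by (rule imageE)
      then show ?thesis by (auto simp: to_slice_def)
    qed
    from this[OF L.Dom_in[OF u]] this[OF L.Cod_in[OF u]]
    obtain G H where G: "is_acset U B S K G" "fst u = over G"
      and H: "is_acset U B S K H" "snd (snd u) = over H"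
      unfolding slice_cat_simps(2,3) by blast
    then obtain \<eta> where u_eq: "u = (over G, (restrict_fctr G B0, \<eta>, restrict_fctr H B0), over H)"
      using u by (cases u) (auto simp: slice_cat_Arr)
    with u obtain \<alpha> where \<alpha>: "(G, \<alpha>, H) \<in> Arr (acset_cat U B S K)" "restrict \<alpha> (Obj B0) = \<eta>"
      using lift_slice_Arr[OF G(1) H(1)] by blast
    then have "u = armap to_slice (G, \<alpha>, H)"
      by (simp add: to_slice_def u_eq)
    then show "u \<in> armap to_slice ` Arr (acset_cat U B S K)"
      using \<alpha>(1) by blast
  qed (use PiE_mem[OF is_functor.armap_in[OF functor_to_slice]] in blast)
qed

lemma isomorphic_acset_slice: "isomorphic_cat (acset_cat U B S K) (slice_cat E D)"
  by (rule isomorphic_catI[OF functor_to_slice bij_Obj_to_slice bij_Arr_to_slice])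

end

section \<open>Choice of the products in the universe\<close>

theorem theorem4p4:
  fixes U :: "'u set set"
    and B :: "('o, 'm) cat"
    and S :: "('o, 'm, nat, nat \<times> nat) fctr"
    and K :: "('o, 'm, 'u set, 'u set \<times> ('u \<Rightarrow> 'u) \<times> 'u set) fctr"
  assumes "schema U B S"
    and "is_functor (fiber B S 1) (set_cat U) K"
  shows "\<exists>D. is_functor (fiber B S 0) (set_cat U) D \<and>
    isomorphic_cat (acset_cat U B S K)
      (slice_cat (functor_cat (fiber B S 0) (set_cat U)) D)"
proof -
  interpret interval_functor B S
    using assms(1) by (simp add: schema_def interval_functor_def)
  interpret K: set_functor "fiber B S 1" U K
    using assms(2) by (simp add: set_functor_def)
  \<comment> \<open>The index set \<open>J c\<close> consists of arrows of \<open>B\<close>, so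
    smallness applies. The product is a set of functions rather than a subset of \<open>'u\<close>,
    hence a member of \<open>U\<close> in bijection with it takes its place.\<close>
  have "\<exists>P h. P \<in> U \<and> bij_betw h P (\<Pi>\<^sub>E s\<in>J c. obmap K (Cod B s))" for c
  proof -
    have "J c \<subseteq> Arr B" "\<forall>s\<in>J c. obmap K (Cod B s) \<in> U"
      using crossing_in K.obmap_U by blast+
    moreover have "small_wrt U (Arr B)"
      using assms(1) by (simp add: schema_def small_cat_def)
    ultimately have "\<exists>P\<in>U. (\<Pi>\<^sub>E s\<in>J c. obmap K (Cod B s)) \<approx> P"
      by (simp add: small_wrt_def)
    then obtain P where "P \<in> U" "(\<Pi>\<^sub>E s\<in>J c. obmap K (Cod B s)) \<approx> P"
      by blast
    then show ?thesis
      using eqpoll_sym unfolding eqpoll_def by blast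
  qed
  then obtain P d where "\<And>c. P c \<in> U"
    and "\<And>c. bij_betw (d c) (P c) (\<Pi>\<^sub>E s\<in>J c. obmap K (Cod B s))"
    by metis
  then interpret typed_schema U B S K P d
    using assms(1) by unfold_locales (simp_all add: schema_def)
  show ?thesis
    using functor_D isomorphic_acset_slice by blast
qed

end
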